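(* Let $\Gamma$ be a finite, simple, strongly connected digraph of order $n\geq 2$ with diameter $d$. Then $f(n,d)\leq \dim(\Gamma)\leq n-d$, where $f(n,d)$ is the least positive integer $k$ for which $k+d^{2k}\geq n$.
   Context: $\partial(x,y)$ is the length of a shortest directed path from $x$ to $y$; $\tilde\partial(x,y)=(\partial(x,y),\partial(y,x))$; the diameter is $\max_{x,y}\partial(x,y)$. A subset $\{w_1,\dots,w_m\}\subseteq V(\Gamma)$ is a weakly resolving set if $(\tilde\partial(w_1,u),\dots,\tilde\partial(w_m,u))\neq(\tilde\partial(w_1,v),\dots,\tilde\partial(w_m,v))$ for all distinct $u,v\in V(\Gamma)$; $\dim(\Gamma)$, the weak metric dimension, is the minimum cardinality of a weakly resolving set. Simple means no loops and at most one arc for each ordered pair of vertices. *)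

theory Defs
  imports "Graph_Theory.Digraph_Component"
begin

text \<open>
  The definitions are meant for the strongly connected instances of the locale \<open>digraph\<close>
  (finite, no loops, no parallel arcs): there a path joins any two vertices and \<open>verts G\<close> is
  weakly resolving, so that the \<open>LEAST\<close> and \<open>Max\<close> terms about \<open>G\<close> denote genuine minima and maxima.
\<close>

definition vdist :: "('a, 'b) pre_digraph \<Rightarrow> 'a \<Rightarrow> 'a \<Rightarrow> nat" where
  "vdist G x y = (LEAST k. \<exists>p. pre_digraph.apath G x p y \<and> length p = k)"

definition two_way_dist :: "('a, 'b) pre_digraph \<Rightarrow> 'a \<Rightarrow> 'a \<Rightarrow> nat \<times> nat" where
  "two_way_dist G x y = (vdist G x y, vdist G y x)"

definition digraph_diameter :: "('a, 'b) pre_digraph \<Rightarrow> nat" where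
  "digraph_diameter G = Max {vdist G x y | x y. x \<in> verts G \<and> y \<in> verts G}"

definition weakly_resolving :: "('a, 'b) pre_digraph \<Rightarrow> 'a set \<Rightarrow> bool" where
  "weakly_resolving G W \<longleftrightarrow> finite W \<and> W \<subseteq> verts G \<and>
     (\<forall>u\<in>verts G. \<forall>v\<in>verts G. u \<noteq> v \<longrightarrow>
        \<not> (\<forall>w\<in>W. two_way_dist G w u = two_way_dist G w v))"

definition weak_metric_dim :: "('a, 'b) pre_digraph \<Rightarrow> nat" where
  "weak_metric_dim G = (LEAST m. \<exists>W. weakly_resolving G W \<and> card W = m)"

definition dim_lower_bound :: "nat \<Rightarrow> nat \<Rightarrow> nat" where
  "dim_lower_bound n d = (LEAST k. 0 < k \<and> n \<le> k + d ^ (2 * k))"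

end

theory Submission
  imports Defs "HOL-Library.FuncSet"
begin

text \<open>
  Lower bound: if \<open>W\<close> resolves and has \<open>k\<close> elements, then the \<open>n - k\<close> vertices outside \<open>W\<close> have
  distinct distance vectors, whose \<open>2 * k\<close> entries lie between \<open>1\<close> and \<open>d\<close>.
  Upper bound: on a shortest path \<open>x\<^sub>0, \<dots>, x\<^sub>d\<close> realising the diameter the distance from
  \<open>x\<^sub>0\<close> separates all vertices, so all vertices except \<open>x\<^sub>1, \<dots>, x\<^sub>d\<close> form a resolving set.
\<close>

text \<open>The conversion only cuts out closed subwalks. \<open>vdist\<close> minimises over
  \<open>apath\<close>s, but a concatenation of shortest walks may repeat vertices; this bound lets
  any walk be used as a competitor.\<close>

lemma (in wf_digraph) length_awalk_to_apath_le:
  assumes "awalk u p v"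
  shows "length (awalk_to_apath p) \<le> length p"
  using assms
proof (induct rule: awalk_to_apath_induct)
  case (path p)
  then have "awalk_to_apath p = p"
    by (auto simp: awalk_to_apath.simps)
  then show ?case by simp
next
  case (decomp p q r s)
  have "p = q @ r @ s"
    using decomp(1-3) by (auto elim!: awalk_cyc_decompE)
  with decomp show ?case
    using step_awalk_to_apath[of u p v q r s] by simp
qed

context wf_digraph
begin

lemma vdist_le_length_awalk:
  assumes "awalk x p y"
  shows "vdist G x y \<le> length p"
proof -
  have "vdist G x y \<le> length (awalk_to_apath p)"
    unfolding vdist_def using apath_awalk_to_apath[OF assms] by (blast intro: Least_le)
  with length_awalk_to_apath_le[OF assms] show ?thesis by linarith
qed

text \<open>Reachability makes the set under \<open>LEAST\<close> nonempty; otherwise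
  \<open>vdist\<close> would be an unspecified number.\<close>

lemma shortest_awalk:
  assumes "x \<rightarrow>\<^sup>* y"
  obtains p where "awalk x p y" "length p = vdist G x y"
proof -
  from assms have "\<exists>k p. apath x p y \<and> length p = k"
    by (auto simp: reachable_apath)
  then have "\<exists>p. apath x p y \<and> length p = vdist G x y"
    unfolding vdist_def by (rule LeastI_ex)
  with that show ?thesis by (auto intro: awalkI_apath)
qed

lemma vdist_self:
  assumes "x \<in> verts G"
  shows "vdist G x x = 0"
  using vdist_le_length_awalk[of x "[]" x] assms by (simp add: awalk_Nil_iff)

lemma vdist_pos:
  assumes "x \<rightarrow>\<^sup>* y" "x \<noteq> y"
  shows "0 < vdist G x y"
proof -
  obtain p where "awalk x p y" "length p = vdist G x y"
    using assms(1) by (rule shortest_awalk)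
  with assms(2) show ?thesis by (cases p) (auto simp: awalk_Nil_iff)
qed

text \<open>Take the vertex reached after \<open>i\<close> steps of a shortest walk to
  \<open>y\<close>. A shorter way to it, followed by the rest of that walk, would beat the distance
  to \<open>y\<close>.\<close>

lemma vertex_at_vdist:
  assumes "x \<rightarrow>\<^sup>* y" "i \<le> vdist G x y"
  obtains z where "z \<in> verts G" "vdist G x z = i"
proof -
  obtain p where p: "awalk x p y" "length p = vdist G x y"
    using assms(1) by (rule shortest_awalk)
  define z where "z = awlast x (take i p)"
  have "awalk x (take i p @ drop i p) y"
    using p(1) by simp
  then have pre: "awalk x (take i p) z" and suf: "awalk z (drop i p) y"
    unfolding awalk_append_iff z_def by auto
  have le: "vdist G x z \<le> i"
    using vdist_le_length_awalk[OF pre] assms(2) p(2) by simp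
  obtain q where q: "awalk x q z" "length q = vdist G x z"
    using reachable_awalkI[OF pre] by (rule shortest_awalk)
  have "vdist G x y \<le> length (q @ drop i p)"
    using q(1) suf by (intro vdist_le_length_awalk awalk_appendI)
  with q(2) p(2) assms(2) le have "vdist G x z = i" by simp
  with that suf show ?thesis by blast
qed

end

lemma (in fin_digraph) finite_vdists:
  "finite {vdist G x y | x y. x \<in> verts G \<and> y \<in> verts G}"
proof -
  have "{vdist G x y | x y. x \<in> verts G \<and> y \<in> verts G}
      = (\<lambda>(x, y). vdist G x y) ` (verts G \<times> verts G)"
    by auto
  then show ?thesis by simp
qed

lemma (in fin_digraph) vdist_le_diameter:
  assumes "x \<in> verts G" "y \<in> verts G"
  shows "vdist G x y \<le> digraph_diameter G"
  unfolding digraph_diameter_def using finite_vdists assms by (intro Max_ge) auto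

lemma (in fin_digraph) diameter_attained:
  assumes "verts G \<noteq> {}"
  obtains x y where "x \<in> verts G" "y \<in> verts G" "vdist G x y = digraph_diameter G"
proof -
  have "digraph_diameter G \<in> {vdist G x y | x y. x \<in> verts G \<and> y \<in> verts G}"
    unfolding digraph_diameter_def using finite_vdists assms by (intro Max_in) auto
  with that show ?thesis by force
qed

lemma (in fin_digraph) resolving_set_from_diameter:
  assumes sc: "strongly_connected G"
  obtains W where "weakly_resolving G W" "card W = card (verts G) - digraph_diameter G"
proof -
  let ?d = "digraph_diameter G"
  have reach: "u \<rightarrow>\<^sup>* v" if "u \<in> verts G" "v \<in> verts G" for u v
    using sc that by (auto simp: strongly_connected_def)
  obtain x y where xy: "x \<in> verts G" "y \<in> verts G" "vdist G x y = ?d"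
    using sc diameter_attained unfolding strongly_connected_def by metis
  have "\<exists>z. z \<in> verts G \<and> vdist G x z = i" if "i \<in> {1..?d}" for i
    using vertex_at_vdist[of x y i] reach xy that by auto
  \<comment> \<open>The vertices \<open>g i\<close> are chosen separately and need not lie on one
    common path: all that matters is that \<open>vdist G x\<close> inverts \<open>g\<close>, which
    makes \<open>g\<close> injective and lets \<open>x\<close> tell its values apart.\<close>
  then obtain g where g: "\<And>i. i \<in> {1..?d} \<Longrightarrow> g i \<in> verts G \<and> vdist G x (g i) = i"
    by metis
  define W where "W = verts G - g ` {1..?d}"
  have "inj_on g {1..?d}"
    using g by (metis inj_onI)
  then have "card W = card (verts G) - ?d"
    unfolding W_def using g by (subst card_Diff_subset) (auto simp: card_image)
  \<comment> \<open>Indices start at 1, so \<open>x\<close>, at distance 0 from itself, is not among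
    the removed vertices.\<close>
  moreover have "x \<in> W"
  proof -
    have "x \<noteq> g i" if "i \<in> {1..?d}" for i
      using g[OF that] vdist_self[OF xy(1)] that by auto
    with xy(1) show ?thesis unfolding W_def by blast
  qed
  moreover have "\<exists>w\<in>W. two_way_dist G w u \<noteq> two_way_dist G w v"
    if uv: "u \<in> verts G" "v \<in> verts G" "u \<noteq> v" for u v
  proof -
    \<comment> \<open>A member of the pair lying in \<open>W\<close> separates the pair itself,
      having distance 0 to itself and positive distance to the other. Only pairs of removed vertices
      need \<open>x\<close>.\<close>
    consider "u \<in> W" | "v \<in> W" | "u \<in> g ` {1..?d}" "v \<in> g ` {1..?d}"
      using uv unfolding W_def by blast
    then show ?thesis
    proof cases
      case 1
      have "vdist G u u \<noteq> vdist G u v"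
        using vdist_self vdist_pos reach uv by (metis less_irrefl)
      with 1 show ?thesis by (metis two_way_dist_def prod.inject)
    next
      case 2
      have "vdist G v v \<noteq> vdist G v u"
        using vdist_self vdist_pos reach uv by (metis less_irrefl)
      with 2 show ?thesis by (metis two_way_dist_def prod.inject)
    next
      case 3
      then have "vdist G x u \<noteq> vdist G x v"
        using g uv(3) by force
      with \<open>x \<in> W\<close> show ?thesis by (auto simp: two_way_dist_def)
    qed
  qed
  ultimately show ?thesis
    using that[of W] by (auto simp: weakly_resolving_def W_def)
qed

lemma (in fin_digraph) order_le_of_weakly_resolving:
  assumes sc: "strongly_connected G" and W: "weakly_resolving G W"
  shows "card (verts G) \<le> card W + digraph_diameter G ^ (2 * card W)"
proof -
  let ?D = "{1..digraph_diameter G}"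
  let ?F = "PiE W (\<lambda>_. ?D \<times> ?D)"
  have fin: "finite W" and sub: "W \<subseteq> verts G"
    using W by (auto simp: weakly_resolving_def)
  \<comment> \<open>Since \<open>v\<close> lies outside \<open>W\<close>, it differs from
    \<open>w\<close>, which excludes the value 0 and leaves \<open>d\<close> rather than
    \<open>d + 1\<close> choices per entry.\<close>
  have rng: "two_way_dist G w v \<in> ?D \<times> ?D" if "w \<in> W" "v \<in> verts G - W" for w v
  proof -
    have "w \<in> verts G" "w \<noteq> v" using that sub by auto
    moreover from this have "w \<rightarrow>\<^sup>* v" "v \<rightarrow>\<^sup>* w"
      using sc that by (auto simp: strongly_connected_def)
    ultimately show ?thesis
      using that vdist_pos[of w v] vdist_pos[of v w] vdist_le_diameter
      by (auto simp: two_way_dist_def Suc_le_eq)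
  qed
  have "card (verts G - W) \<le> card ?F"
  proof (rule card_inj_on_le)
    \<comment> \<open>The distance vector is restricted to \<open>W\<close> so that it is
      extensional and thus lies in the finite set \<open>?F\<close>.\<close>
    show "inj_on (\<lambda>v. \<lambda>w\<in>W. two_way_dist G w v) (verts G - W)"
    proof (rule inj_onI)
      fix u v assume uv: "u \<in> verts G - W" "v \<in> verts G - W"
        and eq: "(\<lambda>w\<in>W. two_way_dist G w u) = (\<lambda>w\<in>W. two_way_dist G w v)"
      have "two_way_dist G w u = two_way_dist G w v" if "w \<in> W" for w
        using fun_cong[OF eq, of w] that by simp
      with uv W show "u = v" unfolding weakly_resolving_def by blast
    qed
    show "(\<lambda>v. \<lambda>w\<in>W. two_way_dist G w v) ` (verts G - W) \<subseteq> ?F"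
      using rng by (intro image_subsetI restrict_PiE_iff[THEN iffD2]) blast
    show "finite ?F"
      using fin by (intro finite_PiE) auto
  qed
  also have "card ?F = digraph_diameter G ^ (2 * card W)"
    using fin by (simp add: card_PiE power_mult power2_eq_square)
  finally show ?thesis
    using card_Diff_subset[OF fin sub] by simp
qed

theorem theorem2p1:
  fixes G :: "('a, 'b) pre_digraph" and n d :: nat
  assumes "digraph G"
    and "strongly_connected G"
    and "n = card (verts G)" and "n \<ge> 2"
    and "d = digraph_diameter G"
  shows "dim_lower_bound n d \<le> weak_metric_dim G \<and> weak_metric_dim G \<le> n - d"
proof -
  interpret digraph G by fact
  obtain W where W: "weakly_resolving G W" "card W = n - d"
    using resolving_set_from_diameter assms(2,3,5) by metis
  have "weak_metric_dim G \<le> n - d"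
    unfolding weak_metric_dim_def using W by (blast intro: Least_le)
  moreover have "\<exists>W. weakly_resolving G W \<and> card W = weak_metric_dim G"
    unfolding weak_metric_dim_def by (rule LeastI_ex) (use W in blast)
  then obtain U where U: "weakly_resolving G U" "card U = weak_metric_dim G"
    by blast
  \<comment> \<open>\<open>dim_lower_bound\<close> minimises over positive \<open>k\<close> only, so
    the dimension must be shown positive; the empty set cannot separate two distinct
    vertices.\<close>
  have "U \<noteq> {}"
  proof
    assume "U = {}"
    with U(1) have "\<forall>u\<in>verts G. \<forall>v\<in>verts G. u = v"
      by (simp add: weakly_resolving_def)
    then have "card (verts G) \<le> 1"
      by (simp add: card_le_Suc0_iff_eq)
    with assms(3,4) show False by simp
  qed
  then have "0 < weak_metric_dim G"
    using U by (auto simp: weakly_resolving_def card_gt_0_iff)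
  then have "dim_lower_bound n d \<le> weak_metric_dim G"
    unfolding dim_lower_bound_def
    using order_le_of_weakly_resolving[OF assms(2) U(1)] U(2) assms(3,5)
    by (simp add: Least_le)
  ultimately show ?thesis by blast
qed

end
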